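(* Let $V:\mathbb{T}^d\to\mathbb{R}$ be analytic, let $\alpha\in\mathbb{R}^d$ satisfy $k\cdot\alpha\neq0$ for all $k\in\mathbb{Z}^d\setminus\{0\}$, let $\epsilon,\lambda\in\mathbb{R}$, and let $(p_n,q_n)\in\mathbb{R}\times\mathbb{T}^d$ be an orbit of the mapping $(p_{n+1},q_{n+1})=F_{\epsilon,\lambda}(p_n,q_n)$ given by $$p_{n+1}=p_n-\epsilon\,\partial_\alpha V(q_n)-\lambda,\qquad q_{n+1}=q_n+\alpha\,p_{n+1},$$ where $\partial_\alpha=\alpha\cdot\nabla$. Assume that the orbit is in the full measure set to which Oseledets' theorem applies. Then, among the $d+1$ Lyapunov exponents of the orbit (counted with multiplicity), $d-1$ are zero. Also, the sum of all the Lyapunov exponents is zero.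
   Context: $\mathbb{T}^d=\mathbb{R}^d/\mathbb{Z}^d$. The phase space $\mathbb{R}\times\mathbb{T}^d$ has dimension $d+1$, and the Lyapunov exponents are those of the derivative cocycle $DF_{\epsilon,\lambda}$ along the orbit. That the orbit is in the set to which Oseledets' (multiplicative ergodic) theorem applies means that the conclusions of that theorem hold along the orbit, i.e. the orbit is Lyapunov regular for the derivative cocycle: the exponential growth rates $\lim_{n}\frac1n\ln\|DF^n_{\epsilon,\lambda}(p_0,q_0)w\|$ exist for all nonzero tangent vectors $w$, and the sum of the exponents counted with multiplicity equals $\lim_n\frac1n\ln|\det DF^n_{\epsilon,\lambda}(p_0,q_0)|$. *)

theory Defs
  imports "HOL-Analysis.Analysis" "HOL-Library.Multiset"
begin

text \<open>The dimension \<open>d\<close> is the cardinality of a finite (nonempty) index type \<open>'d\<close>.\<close>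

quotient_type (overloaded) 'd torus = "real ^ ('d::finite)" / "\<lambda>x y. \<forall>i. x $ i - y $ i \<in> \<int>"
proof (rule equivpI)
  show "reflp (\<lambda>x y :: real ^ 'd. \<forall>i. x $ i - y $ i \<in> \<int>)"
    by (simp add: reflp_def)
  show "symp (\<lambda>x y :: real ^ 'd. \<forall>i. x $ i - y $ i \<in> \<int>)"
    by (auto simp: symp_def) (metis Ints_minus minus_diff_eq)
  show "transp (\<lambda>x y :: real ^ 'd. \<forall>i. x $ i - y $ i \<in> \<int>)"
  proof (rule transpI, rule allI)
    fix x y z :: "real ^ 'd" and i
    assume "\<forall>i. x $ i - y $ i \<in> \<int>" and "\<forall>i. y $ i - z $ i \<in> \<int>"
    then have "(x $ i - y $ i) + (y $ i - z $ i) \<in> \<int>"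
      by (intro Ints_add) simp_all
    then show "x $ i - z $ i \<in> \<int>"
      by simp
  qed
qed

lift_definition translate :: "('d::finite) torus \<Rightarrow> real ^ 'd \<Rightarrow> 'd torus"
  is "\<lambda>x v. x + v"
  by simp

text \<open>
  Real analyticity on the torus: near every point \<open>q\<close>, the function \<open>h \<mapsto> V (q + h)\<close> is the sum
  of a (necessarily absolutely) convergent power series in \<open>h\<close>, indexed by multi-indices
  \<open>k :: 'd \<Rightarrow> nat\<close>.
\<close>

definition torus_analytic :: "(('d::finite) torus \<Rightarrow> real) \<Rightarrow> bool" where
  "torus_analytic V \<longleftrightarrow> (\<forall>q. \<exists>r>0. \<exists>c :: ('d \<Rightarrow> nat) \<Rightarrow> real. \<forall>h. norm h < r \<longrightarrow>
     ((\<lambda>k. c k * (\<Prod>i\<in>UNIV. (h $ i) ^ k i)) has_sum V (translate q h)) UNIV)"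

definition torus_grad :: "(('d::finite) torus \<Rightarrow> real) \<Rightarrow> 'd torus \<Rightarrow> real ^ 'd" where
  "torus_grad V q = (\<chi> i. deriv (\<lambda>t. V (translate q (t *\<^sub>R axis i 1))) 0)"

definition F_map :: "(('d::finite) torus \<Rightarrow> real) \<Rightarrow> real ^ 'd \<Rightarrow> real \<Rightarrow> real \<Rightarrow>
    real \<times> 'd torus \<Rightarrow> real \<times> 'd torus" where
  "F_map V \<alpha> \<epsilon> lam = (\<lambda>(p, q).
     let p' = p - \<epsilon> * (\<alpha> \<bullet> torus_grad V q) - lam in (p', translate q (p' *\<^sub>R \<alpha>)))"

text \<open>
  The tangent space of \<open>\<real> \<times> \<T>\<^sup>d\<close> at every point is \<open>\<real> \<times> \<real>\<^sup>d\<close>, and \<open>w \<mapsto> move z w\<close> (for small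
  \<open>w\<close>) is the standard chart around \<open>z\<close>.  A map \<open>G\<close> has derivative \<open>D\<close> at \<open>z\<close> if its expression
  \<open>g\<close> in the charts around \<open>z\<close> and \<open>G z\<close> has derivative \<open>D\<close> at the origin.
\<close>

definition move :: "real \<times> ('d::finite) torus \<Rightarrow> real \<times> (real ^ 'd) \<Rightarrow> real \<times> 'd torus" where
  "move = (\<lambda>(p, q) (a, h). (p + a, translate q h))"

definition has_phase_derivative :: "(real \<times> ('d::finite) torus \<Rightarrow> real \<times> 'd torus) \<Rightarrow>
    (real \<times> (real ^ 'd) \<Rightarrow> real \<times> (real ^ 'd)) \<Rightarrow> real \<times> 'd torus \<Rightarrow> bool" where
  "has_phase_derivative G D z \<longleftrightarrow> (\<exists>g. (g has_derivative D) (at 0) \<and> g 0 = 0 \<and>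
     (\<forall>\<^sub>F w in nhds 0. G (move z w) = move (G z) (g w)))"

lemma translate_eq_imp_eq:
  assumes "translate q h = translate q k" and "norm (h - k) < 1"
  shows "h = k"
proof -
  have "\<forall>i. (h - k) $ i \<in> \<int>"
    using assms(1) by transfer simp
  moreover have "\<bar>(h - k) $ i\<bar> < 1" for i
    using component_le_norm_cart[of "h - k" i] assms(2) by linarith
  ultimately have "(h - k) $ i = 0" for i
    by (intro Ints_nonzero_abs_less1) simp_all
  then show ?thesis
    by (simp add: vec_eq_iff)
qed

lemma has_phase_derivative_unique:
  assumes "has_phase_derivative G D z" and "has_phase_derivative G D' z"
  shows "D = D'"
proof -
  obtain g where g: "(g has_derivative D) (at 0)" "g 0 = 0"
    "\<forall>\<^sub>F w in nhds 0. G (move z w) = move (G z) (g w)"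
    using assms(1) unfolding has_phase_derivative_def by blast
  obtain g' where g': "(g' has_derivative D') (at 0)" "g' 0 = 0"
    "\<forall>\<^sub>F w in nhds 0. G (move z w) = move (G z) (g' w)"
    using assms(2) unfolding has_phase_derivative_def by blast
  have "((\<lambda>w. g w - g' w) \<longlongrightarrow> g 0 - g' 0) (nhds 0)"
    using has_derivative_continuous[OF g(1)] has_derivative_continuous[OF g'(1)]
    unfolding isCont_def tendsto_at_iff_tendsto_nhds by (rule tendsto_diff)
  then have "\<forall>\<^sub>F w in nhds 0. norm (g w - g' w) < 1"
    using tendstoD[of "\<lambda>w. g w - g' w" 0 "nhds 0" 1] g(2) g'(2) by (simp add: dist_norm)
  with g(3) g'(3) have "\<forall>\<^sub>F w in nhds 0. g w = g' w"
  proof eventually_elim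
    case (elim w)
    have "move (G z) (g w) = move (G z) (g' w)"
      using elim by simp
    then have 1: "fst (g w) = fst (g' w)"
      and 2: "translate (snd (G z)) (snd (g w)) = translate (snd (G z)) (snd (g' w))"
      by (simp_all add: move_def case_prod_unfold)
    have "norm (snd (g w) - snd (g' w)) \<le> norm (g w - g' w)"
      using norm_snd_le[of "snd (g w - g' w)" "fst (g w - g' w)"]
      unfolding prod.collapse by (simp only: snd_diff)
    with elim(3) have "norm (snd (g w) - snd (g' w)) < 1"
      by linarith
    with 2 have "snd (g w) = snd (g' w)"
      by (rule translate_eq_imp_eq)
    with 1 show ?case
      by (simp add: prod_eq_iff)
  qed
  then obtain S where S: "open S" "0 \<in> S" "\<And>w. w \<in> S \<Longrightarrow> g' w = g w"
    unfolding eventually_nhds by metis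
  have "(g has_derivative D') (at 0)"
    using g'(1) S by (rule has_derivative_transform_within_open)
  with g(1) show ?thesis
    by (rule has_derivative_unique)
qed

definition phase_derivative :: "(real \<times> ('d::finite) torus \<Rightarrow> real \<times> 'd torus) \<Rightarrow>
    real \<times> 'd torus \<Rightarrow> real \<times> (real ^ 'd) \<Rightarrow> real \<times> (real ^ 'd)" where
  "phase_derivative G z = (THE D. has_phase_derivative G D z)"

definition derivative_cocycle :: "(real \<times> ('d::finite) torus \<Rightarrow> real \<times> 'd torus) \<Rightarrow>
    real \<times> 'd torus \<Rightarrow> nat \<Rightarrow> real \<times> (real ^ 'd) \<Rightarrow> real \<times> (real ^ 'd)" where
  "derivative_cocycle G z n = phase_derivative (G ^^ n) z"

text \<open>
  The determinant of an endomorphism of \<open>\<real> \<times> \<real>\<^sup>d\<close>, computed from its matrix with rows and columns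
  indexed by \<open>'d option\<close>; the index \<open>None\<close> stands for the first factor.
\<close>

definition to_vec :: "real \<times> (real ^ ('d::finite)) \<Rightarrow> real ^ ('d option)" where
  "to_vec w = (\<chi> i. case i of None \<Rightarrow> fst w | Some j \<Rightarrow> snd w $ j)"

definition of_vec :: "real ^ (('d::finite) option) \<Rightarrow> real \<times> (real ^ 'd)" where
  "of_vec v = (v $ None, \<chi> j. v $ Some j)"

definition phase_det :: "(real \<times> (real ^ ('d::finite)) \<Rightarrow> real \<times> (real ^ 'd)) \<Rightarrow> real" where
  "phase_det A = det (matrix (to_vec \<circ> A \<circ> of_vec))"

text \<open>
  In what follows \<open>A n\<close> is the \<open>n\<close>-th step of a cocycle of invertible linear maps along a fixed
  orbit (so that the convention \<open>ln 0 = 0\<close> plays no role).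
\<close>

definition growth :: "(nat \<Rightarrow> 'a \<Rightarrow> 'a) \<Rightarrow> ('a::euclidean_space) \<Rightarrow> nat \<Rightarrow> real" where
  "growth A w n = ln (norm (A n w)) / real n"

definition lyap_exponent :: "(nat \<Rightarrow> 'a \<Rightarrow> 'a) \<Rightarrow> ('a::euclidean_space) \<Rightarrow> real" where
  "lyap_exponent A w = lim (growth A w)"

text \<open>
  Provided that all growth rates converge, the two sets below are linear subspaces; the multiplicity
  of an exponent is the jump of dimension of the associated filtration.  There are then at most
  \<open>DIM('a)\<close> distinct exponents, so the sum defining the multiset is a finite one.
\<close>

definition lyap_multiplicity :: "(nat \<Rightarrow> 'a \<Rightarrow> 'a::euclidean_space) \<Rightarrow> real \<Rightarrow> nat" where
  "lyap_multiplicity A \<mu> =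
     dim {w. w = 0 \<or> lyap_exponent A w \<le> \<mu>} - dim {w. w = 0 \<or> lyap_exponent A w < \<mu>}"

definition lyap_exponents :: "(nat \<Rightarrow> 'a \<Rightarrow> 'a::euclidean_space) \<Rightarrow> real multiset" where
  "lyap_exponents A =
     (\<Sum>\<mu>\<in>lyap_exponent A ` (- {0}). replicate_mset (lyap_multiplicity A \<mu>) \<mu>)"

definition lyapunov_regular ::
    "(nat \<Rightarrow> real \<times> (real ^ 'd) \<Rightarrow> real \<times> (real ^ ('d::finite))) \<Rightarrow> bool" where
  "lyapunov_regular A \<longleftrightarrow>
     (\<forall>w. w \<noteq> 0 \<longrightarrow> convergent (growth A w)) \<and>
     (\<lambda>n. ln \<bar>phase_det (A n)\<bar> / real n) \<longlonglongrightarrow> sum_mset (lyap_exponents A)"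

end

theory Submission
  imports Defs
begin

text \<open>
  Let \<open>\<psi>\<close> be the derivative of \<open>\<epsilon> \<partial>\<^sub>\<alpha>V\<close>. The derivative of the map is
  \<open>(a, h) \<mapsto> (a', h + a'\<alpha>)\<close> with \<open>a' = a - \<psi> h\<close>, a product of two shears. So every step of the
  cocycle has determinant 1, and regularity makes the sum of the exponents zero. Every step also
  preserves the plane \<open>E = \<real> \<times> \<real>\<alpha>\<close> and its area, and acts as the identity modulo \<open>E\<close>. Hence vectors
  outside \<open>E\<close> have exponents \<open>\<ge> 0\<close>, and independent vectors of \<open>E\<close> have exponents with sum
  \<open>\<ge> 0\<close>. So at most one exponent is negative, and if \<open>-\<mu>\<close> is one, then some vector of \<open>E\<close> has an
  exponent \<open>\<ge> \<mu>\<close>. The other exponents are nonnegative and their sum is \<open>\<le> 0\<close>, so they vanish.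
\<close>

section \<open>Differentiating multivariate power series\<close>

text \<open>By the mean value theorem the difference quotients satisfy the same bound as the derivatives,
  so the limit and the sum can be interchanged.\<close>

lemma has_field_derivative_infsum:
  fixes f f' :: "'a \<Rightarrow> real \<Rightarrow> real"
  assumes r: "r > 0"
    and f: "\<And>k t. \<bar>t - x\<bar> < r \<Longrightarrow> (f k has_field_derivative f' k t) (at t)"
    and bound: "\<And>k t. \<bar>t - x\<bar> < r \<Longrightarrow> \<bar>f' k t\<bar> \<le> M k"
    and M: "M summable_on A"
    and summable: "\<And>t. \<bar>t - x\<bar> < r \<Longrightarrow> (\<lambda>k. f k t) summable_on A"
  shows "((\<lambda>t. \<Sum>\<^sub>\<infinity>k\<in>A. f k t) has_field_derivative (\<Sum>\<^sub>\<infinity>k\<in>A. f' k x)) (at x)"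
proof -
  define g where "g k h = (f k (x + h) - f k x) / h" for k h
  let ?Y = "{-r<..<r} - {0}"
  have g_bound: "norm (g k h) \<le> M k" if h: "h \<in> ?Y" for k h
  proof -
    have "\<bar>f k (x + h) - f k x\<bar> \<le> M k * \<bar>x + h - x\<bar>"
      unfolding real_norm_def[symmetric]
    proof (rule field_differentiable_bound)
      show "convex {x - \<bar>h\<bar>..x + \<bar>h\<bar>}" by simp
      show "(f k has_field_derivative f' k t) (at t within {x - \<bar>h\<bar>..x + \<bar>h\<bar>})"
        if "t \<in> {x - \<bar>h\<bar>..x + \<bar>h\<bar>}" for t
        using that h by (intro has_field_derivative_at_within[OF f]) auto
      show "norm (f' k t) \<le> M k" if "t \<in> {x - \<bar>h\<bar>..x + \<bar>h\<bar>}" for t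
        using that h by (auto intro!: bound)
    qed auto
    then show ?thesis
      using h by (simp add: g_def field_simps abs_mult)
  qed
  have "uniform_limit ?Y (\<lambda>X h. \<Sum>k\<in>X. g k h) (\<lambda>h. \<Sum>\<^sub>\<infinity>k\<in>A. g k h) (finite_subsets_at_top A)"
    using g_bound M by (rule Weierstrass_m_test_general)
  moreover have near: "\<forall>\<^sub>F h in at 0. h \<in> ?Y"
    using r by (intro eventually_at_in_open) auto
  moreover have "((\<lambda>h. \<Sum>k\<in>X. g k h) \<longlongrightarrow> (\<Sum>k\<in>X. f' k x)) (at 0)" for X
    using f[of x] r unfolding g_def by (intro tendsto_sum) (simp add: DERIV_def)
  moreover have "((\<lambda>X. \<Sum>k\<in>X. f' k x) \<longlongrightarrow> (\<Sum>\<^sub>\<infinity>k\<in>A. f' k x)) (finite_subsets_at_top A)"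
  proof (rule infsum_tendsto)
    have "(\<lambda>k. norm (f' k x)) summable_on A"
      using M by (rule Infinite_Sum.abs_summable_on_comparison_test') (use bound[of x] r in auto)
    then show "(\<lambda>k. f' k x) summable_on A"
      by (rule abs_summable_summable)
  qed
  ultimately have lim: "((\<lambda>h. \<Sum>\<^sub>\<infinity>k\<in>A. g k h) \<longlongrightarrow> (\<Sum>\<^sub>\<infinity>k\<in>A. f' k x)) (at 0)"
    by (intro swap_uniform_limit'[where f = "\<lambda>X h. \<Sum>k\<in>X. g k h" and S = ?Y
          and F = "finite_subsets_at_top A" and g = "\<lambda>X. \<Sum>k\<in>X. f' k x"]) auto
  have "\<forall>\<^sub>F h in at 0. (\<Sum>\<^sub>\<infinity>k\<in>A. g k h) = ((\<Sum>\<^sub>\<infinity>k\<in>A. f k (x + h)) - (\<Sum>\<^sub>\<infinity>k\<in>A. f k x)) / h"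
    using near
  proof eventually_elim
    case (elim h)
    have "(\<lambda>k. f k (x + h)) summable_on A" "(\<lambda>k. f k x) summable_on A"
      using elim r by (auto intro!: summable)
    then have "((\<lambda>k. g k h) has_sum ((\<Sum>\<^sub>\<infinity>k\<in>A. f k (x + h)) - (\<Sum>\<^sub>\<infinity>k\<in>A. f k x)) / h) A"
      unfolding g_def divide_inverse diff_conv_add_uminus
      by (intro has_sum_cmult_left has_sum_add has_sum_uminusI has_sum_infsum)
    then show ?case by (rule infsumI)
  qed
  with lim show ?thesis
    unfolding DERIV_def by (rule Lim_transform_eventually)
qed

section \<open>Monomials and power series in several variables\<close>

definition multi_power :: "real ^ 'd \<Rightarrow> ('d::finite \<Rightarrow> nat) \<Rightarrow> real" where
  "multi_power x k = (\<Prod>i\<in>UNIV. (x $ i) ^ k i)"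

definition degree_of :: "('d::finite \<Rightarrow> nat) \<Rightarrow> nat" where
  "degree_of k = (\<Sum>i\<in>UNIV. k i)"

lemma prod_power_le:
  fixes x :: "'a \<Rightarrow> real"
  assumes "\<And>i. i \<in> I \<Longrightarrow> \<bar>x i\<bar> \<le> s"
  shows "\<bar>\<Prod>i\<in>I. x i ^ k i\<bar> \<le> s ^ (\<Sum>i\<in>I. k i)"
proof -
  have "\<bar>\<Prod>i\<in>I. x i ^ k i\<bar> = (\<Prod>i\<in>I. \<bar>x i\<bar> ^ k i)"
    by (simp add: abs_prod power_abs)
  also have "\<dots> \<le> (\<Prod>i\<in>I. s ^ k i)"
    using assms by (intro prod_mono) (auto intro: power_mono)
  finally show ?thesis by (simp add: power_sum)
qed

lemma multi_power_le:
  assumes "\<And>i. \<bar>x $ i\<bar> \<le> s"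
  shows "\<bar>multi_power x k\<bar> \<le> s ^ degree_of k"
  unfolding multi_power_def degree_of_def using assms by (rule prod_power_le)

lemma multi_power_split:
  "multi_power x k = x $ i ^ k i * (\<Prod>j\<in>UNIV - {i}. (x $ j) ^ k j)"
  unfolding multi_power_def by (simp add: prod.remove[of UNIV i])

lemma degree_of_split: "degree_of k = k i + (\<Sum>j\<in>UNIV - {i}. k j)"
  unfolding degree_of_def by (simp add: sum.remove[of UNIV i])

lemma degree_of_Suc: "degree_of (k(i := Suc (k i))) = Suc (degree_of k)"
  by (simp add: degree_of_split[of _ i])

lemma differentiable_multi_power: "(\<lambda>x. multi_power x k) differentiable at x"
  unfolding multi_power_def differentiable_def
  by (rule exI, rule has_derivative_prod, rule has_derivative_power,
      rule bounded_linear.has_derivative[OF bounded_linear_vec_nth], rule has_derivative_ident)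

lemma finite_degree_le: "finite {k :: 'd::finite \<Rightarrow> nat. degree_of k \<le> n}"
proof (rule finite_subset)
  show "{k :: 'd \<Rightarrow> nat. degree_of k \<le> n} \<subseteq> PiE UNIV (\<lambda>_. {..n})"
  proof
    fix k :: "'d \<Rightarrow> nat" assume k: "k \<in> {k. degree_of k \<le> n}"
    have "k i \<le> n" for i
      using k degree_of_split[of k i] by simp
    then show "k \<in> PiE UNIV (\<lambda>_. {..n})" by auto
  qed
qed (simp add: finite_PiE)

lemma multi_power_summable:
  assumes "(\<lambda>k. \<bar>c k\<bar> * \<rho> ^ degree_of k) summable_on UNIV" "\<And>i. \<bar>x $ i\<bar> \<le> \<rho>"
  shows "(\<lambda>k. c k * multi_power x k) summable_on UNIV"
proof (rule abs_summable_summable)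
  show "(\<lambda>k. norm (c k * multi_power x k)) summable_on UNIV"
    using assms(1)
  proof (rule Infinite_Sum.abs_summable_on_comparison_test')
    show "norm (c k * multi_power x k) \<le> \<bar>c k\<bar> * \<rho> ^ degree_of k" for k
      using multi_power_le[of x \<rho> k, OF assms(2)] by (simp add: abs_mult mult_left_mono)
  qed
qed

text \<open>The monomials of degree at most 1 form a differentiable finite sum \<open>P\<close>. The
  remainder \<open>R\<close> is bounded by a constant times the square of \<open>norm x\<close>, so
  its derivative at 0 vanishes.\<close>

lemma multi_power_series_differentiable_at_0:
  assumes \<rho>: "\<rho> > 0" and c: "(\<lambda>k. \<bar>c k\<bar> * \<rho> ^ degree_of k) summable_on UNIV"
  shows "(\<lambda>x::real^'d::finite. \<Sum>\<^sub>\<infinity>k. c k * multi_power x k) differentiable at 0"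
proof -
  let ?L = "{k :: 'd \<Rightarrow> nat. degree_of k \<le> 1}"
  define P where "P x = (\<Sum>k\<in>?L. c k * multi_power x k)" for x
  define R where "R x = (\<Sum>\<^sub>\<infinity>k\<in>-?L. c k * multi_power x k)" for x
  define C where "C = (\<Sum>\<^sub>\<infinity>k\<in>-?L. \<bar>c k\<bar> * \<rho> ^ degree_of k)"
  have c': "(\<lambda>k. \<bar>c k\<bar> * \<rho> ^ degree_of k) summable_on -?L"
    using c by (rule summable_on_subset_banach) simp
  have comp: "\<bar>x $ i\<bar> \<le> norm x" for x :: "real^'d" and i
    by (rule component_le_norm_cart)
  have smbl: "(\<lambda>k. c k * multi_power x k) summable_on S" if "norm x < \<rho>" for x S
    using multi_power_summable[OF c, of x] comp[of x] that
    by (meson less_imp_le order_trans summable_on_subset_banach subset_UNIV)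
  have split: "(\<Sum>\<^sub>\<infinity>k. c k * multi_power x k) = P x + R x" if x: "norm x < \<rho>" for x
    using infsum_Un_disjoint[OF smbl[OF x] smbl[OF x], of ?L "-?L"]
      by (simp add: P_def R_def finite_degree_le)
  have R_bound: "\<bar>R x\<bar> \<le> (norm x / \<rho>)\<^sup>2 * C" if x: "norm x < \<rho>" for x
    unfolding real_norm_def[symmetric]
  proof (rule norm_infsum_le)
    show "((\<lambda>k. c k * multi_power x k) has_sum R x) (-?L)"
      unfolding R_def using smbl[OF x] by (rule has_sum_infsum)
    show "((\<lambda>k. (norm x / \<rho>)\<^sup>2 * (\<bar>c k\<bar> * \<rho> ^ degree_of k)) has_sum (norm x / \<rho>)\<^sup>2 * C) (-?L)"
      unfolding C_def using c' by (intro has_sum_cmult_right has_sum_infsum)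
    \<comment> \<open>A degree of at least 2 lets two factors \<open>norm x / \<rho>\<close> be
      pulled out of the monomial; the rest is bounded by the majorant at radius
      \<open>\<rho>\<close>.\<close>
    fix k assume "k \<in> -?L"
    then obtain m where m: "degree_of k = 2 + m"
      by (metis Compl_iff less_eqE mem_Collect_eq not_less_eq_eq numeral_2_eq_2 One_nat_def)
    have "\<bar>multi_power x k\<bar> \<le> norm x ^ degree_of k"
      by (rule multi_power_le) (rule comp)
    also have "\<dots> = norm x ^ 2 * norm x ^ m"
      by (simp only: m power_add)
    also have "\<dots> \<le> norm x ^ 2 * \<rho> ^ m"
      using x by (intro mult_left_mono power_mono) auto
    also have "\<dots> = (norm x / \<rho>)\<^sup>2 * \<rho> ^ degree_of k"
      using \<rho> by (simp add: m power_divide power_add power2_eq_square)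
    finally have "\<bar>c k\<bar> * \<bar>multi_power x k\<bar> \<le> \<bar>c k\<bar> * ((norm x / \<rho>)\<^sup>2 * \<rho> ^ degree_of k)"
      by (rule mult_left_mono) simp
    then show "norm (c k * multi_power x k) \<le> (norm x / \<rho>)\<^sup>2 * (\<bar>c k\<bar> * \<rho> ^ degree_of k)"
      by (simp add: abs_mult ac_simps)
  qed
  have R0: "R 0 = 0"
    using R_bound[of 0] \<rho> by simp
  have "(R has_derivative (\<lambda>_. 0)) (at 0)"
  proof (rule has_derivativeI_sandwich[OF \<rho>])
    show "norm (R y - R 0 - 0) / norm (y - 0) \<le> norm y * (C / \<rho>\<^sup>2)"
      if "y \<noteq> 0" "dist y 0 < \<rho>" for y
      using R_bound[of y] that \<rho> by (simp add: R0 divide_simps power2_eq_square ac_simps)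
    show "((\<lambda>y. norm y * (C / \<rho>\<^sup>2)) \<longlongrightarrow> 0) (at 0)"
      by (rule tendsto_mult_left_zero[OF tendsto_norm_zero[OF tendsto_ident_at]])
  qed auto
  moreover have "P differentiable at 0"
    unfolding P_def [abs_def]
    by (intro differentiable_sum finite_degree_le ballI differentiable_mult differentiable_multi_power) simp
  ultimately have "(\<lambda>x. P x + R x) differentiable at 0"
    by (intro differentiable_add) (auto simp: differentiable_def)
  then obtain D where "((\<lambda>x. P x + R x) has_derivative D) (at 0)"
    by (auto simp: differentiable_def)
  then have "((\<lambda>x. \<Sum>\<^sub>\<infinity>k. c k * multi_power x k) has_derivative D) (at 0)"
    by (rule has_derivative_transform_within_open[where s = "ball 0 \<rho>"])
      (use \<rho> in \<open>auto simp: split\<close>)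
  then show ?thesis
    by (auto simp: differentiable_def)
qed

text \<open>Shrinking the radius absorbs the factor that differentiating a monomial produces.\<close>

lemma power_halved_le:
  assumes "(\<rho>::real) > 0"
  shows "real n * (\<rho> / 2) ^ (n - 1) \<le> 2 / \<rho> * \<rho> ^ n"
proof (cases n)
  case (Suc m)
  have "real n \<le> 2 ^ n"
    using less_exp[of n] by (metis less_imp_le of_nat_le_iff of_nat_numeral of_nat_power)
  then have "real n * \<rho> ^ m \<le> 2 ^ n * \<rho> ^ m"
    using assms by (intro mult_right_mono) auto
  with assms show ?thesis
    by (simp add: Suc power_divide field_simps)
qed (use assms in simp)

text \<open>The coefficients of the formal partial derivative in direction \<open>i\<close>. The
  index \<open>k\<close> is the exponent after differentiation, hence the shift by
  \<open>Suc\<close>.\<close>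

definition partial_coeff :: "(('d \<Rightarrow> nat) \<Rightarrow> real) \<Rightarrow> 'd \<Rightarrow> ('d \<Rightarrow> nat) \<Rightarrow> real" where
  "partial_coeff c i k = real (Suc (k i)) * c (k(i := Suc (k i)))"

context
  fixes c :: "('d::finite \<Rightarrow> nat) \<Rightarrow> real" and \<rho> :: real
  assumes \<rho>: "\<rho> > 0" and c: "(\<lambda>k. \<bar>c k\<bar> * \<rho> ^ degree_of k) summable_on UNIV"
begin

text \<open>Raising the \<open>i\<close>-th exponent is injective, so the shifted coefficients are a
  subfamily of the old ones. Differentiation adds a factor of at most the degree, which halving the
  radius absorbs.\<close>

lemma partial_coeff_summable:
  "(\<lambda>k. \<bar>partial_coeff c i k\<bar> * (\<rho> / 2) ^ degree_of k) summable_on UNIV"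
proof (rule summable_on_comparison_test)
  let ?s = "\<lambda>k :: 'd \<Rightarrow> nat. k(i := Suc (k i))"
  have inj: "inj ?s"
    by (rule injI) (metis fun_upd_same fun_upd_triv fun_upd_upd nat.inject)
  have "(\<lambda>k. \<bar>c k\<bar> * \<rho> ^ degree_of k) summable_on range ?s"
    using c by (rule summable_on_subset_banach) simp
  then have "(\<lambda>k. \<bar>c (?s k)\<bar> * \<rho> ^ degree_of (?s k)) summable_on UNIV"
    by (simp add: summable_on_reindex[OF inj] o_def)
  then show "(\<lambda>k. 2 / \<rho> * (\<bar>c (?s k)\<bar> * \<rho> ^ degree_of (?s k))) summable_on UNIV"
    by (rule summable_on_cmult_right)
  fix k :: "'d \<Rightarrow> nat"
  have "real (Suc (k i)) * (\<rho> / 2) ^ degree_of k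
      \<le> real (Suc (degree_of k)) * (\<rho> / 2) ^ degree_of k"
    using \<rho> by (intro mult_right_mono) (simp_all only: degree_of_split[of k i], auto)
  also have "\<dots> \<le> 2 / \<rho> * \<rho> ^ degree_of (?s k)"
    using power_halved_le[OF \<rho>, of "Suc (degree_of k)"] by (simp add: degree_of_Suc)
  finally have "\<bar>c (?s k)\<bar> * (real (Suc (k i)) * (\<rho> / 2) ^ degree_of k)
      \<le> \<bar>c (?s k)\<bar> * (2 / \<rho> * \<rho> ^ degree_of (?s k))"
    by (rule mult_left_mono) simp
  then show "\<bar>partial_coeff c i k\<bar> * (\<rho> / 2) ^ degree_of k
      \<le> 2 / \<rho> * (\<bar>c (?s k)\<bar> * \<rho> ^ degree_of (?s k))"
    by (simp add: partial_coeff_def abs_mult ac_simps)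
qed (use \<rho> in auto)

text \<open>Termwise differentiation along the \<open>i\<close>-th axis; the majorant is
  \<open>2 / \<rho>\<close> times that of the series itself.\<close>

lemma multi_power_series_partial:
  assumes x: "\<And>j. \<bar>x $ j\<bar> < \<rho> / 2"
  shows "((\<lambda>t. \<Sum>\<^sub>\<infinity>k. c k * multi_power (x + t *\<^sub>R axis i 1) k) has_field_derivative
          (\<Sum>\<^sub>\<infinity>k. partial_coeff c i k * multi_power x k)) (at 0)"
proof -
  \<comment> \<open>\<open>Q k\<close> is the monomial without its \<open>i\<close>-th variable,
    hence constant along the line. As long as \<open>t\<close> stays below \<open>\<delta>\<close>
    in absolute value, the \<open>i\<close>-th coordinate stays within
    \<open>\<rho> / 2\<close>.\<close>
  define Q where "Q k = (\<Prod>j\<in>UNIV - {i}. (x $ j) ^ k j)" for k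
  define f' where "f' k t = c k * (real (k i) * (x $ i + t) ^ (k i - 1) * Q k)" for k t
  define \<delta> where "\<delta> = \<rho> / 2 - \<bar>x $ i\<bar>"
  have \<delta>: "\<delta> > 0" using x[of i] by (simp add: \<delta>_def)
  have mp: "multi_power (x + t *\<^sub>R axis i 1) k = (x $ i + t) ^ k i * Q k" for t k
    by (auto simp: multi_power_split[of _ _ i] Q_def axis_def intro!: prod.cong)
  have "((\<lambda>t. \<Sum>\<^sub>\<infinity>k. c k * multi_power (x + t *\<^sub>R axis i 1) k) has_field_derivative
          (\<Sum>\<^sub>\<infinity>k. f' k 0)) (at 0)"
  proof (rule has_field_derivative_infsum[OF \<delta>])
    fix k and t :: real assume t: "\<bar>t - 0\<bar> < \<delta>"
    then have t': "\<bar>x $ i + t\<bar> \<le> \<rho> / 2"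
      unfolding \<delta>_def by linarith
    show "((\<lambda>t. c k * multi_power (x + t *\<^sub>R axis i 1) k) has_field_derivative f' k t) (at t)"
      unfolding mp f'_def by (rule derivative_eq_intros refl | simp)+
    have "\<bar>Q k\<bar> \<le> \<rho> ^ (\<Sum>j\<in>UNIV - {i}. k j)"
      unfolding Q_def using \<rho> by (intro prod_power_le order_trans[OF less_imp_le[OF x]]) simp
    moreover have "real (k i) * \<bar>x $ i + t\<bar> ^ (k i - 1) \<le> 2 / \<rho> * \<rho> ^ k i"
      by (rule order_trans[OF mult_left_mono[OF power_mono[OF t']] power_halved_le[OF \<rho>]]) simp_all
    ultimately have "(real (k i) * \<bar>x $ i + t\<bar> ^ (k i - 1)) * \<bar>Q k\<bar>
        \<le> (2 / \<rho> * \<rho> ^ k i) * \<rho> ^ (\<Sum>j\<in>UNIV - {i}. k j)"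
      using \<rho> by (intro mult_mono[of _ "2 / \<rho> * \<rho> ^ k i"]) auto
    also have "\<dots> = 2 / \<rho> * \<rho> ^ degree_of k"
      by (simp add: degree_of_split[of k i] power_add)
    finally have "\<bar>c k\<bar> * ((real (k i) * \<bar>x $ i + t\<bar> ^ (k i - 1)) * \<bar>Q k\<bar>)
        \<le> \<bar>c k\<bar> * (2 / \<rho> * \<rho> ^ degree_of k)"
      by (rule mult_left_mono) simp
    then show "\<bar>f' k t\<bar> \<le> 2 / \<rho> * (\<bar>c k\<bar> * \<rho> ^ degree_of k)"
      by (simp add: f'_def abs_mult power_abs ac_simps)
  next
    show "(\<lambda>k. 2 / \<rho> * (\<bar>c k\<bar> * \<rho> ^ degree_of k)) summable_on UNIV"
      using c by (rule summable_on_cmult_right)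
    fix t :: real assume t: "\<bar>t - 0\<bar> < \<delta>"
    have "\<bar>(x + t *\<^sub>R axis i 1) $ j\<bar> \<le> \<rho>" for j
      using t x[of j] \<rho> by (cases "j = i") (auto simp: \<delta>_def axis_def)
    then show "(\<lambda>k. c k * multi_power (x + t *\<^sub>R axis i 1) k) summable_on UNIV"
      by (rule multi_power_summable[OF c])
  qed
  \<comment> \<open>Terms with \<open>k i = 0\<close> vanish because of the factor
    \<open>real (k i)\<close>. On the remaining indices, lowering the \<open>i\<close>-th exponent
    is a bijection onto all multi-indices.\<close>
  also have "(\<Sum>\<^sub>\<infinity>k. f' k 0) = (\<Sum>\<^sub>\<infinity>k\<in>{k. k i \<noteq> 0}. f' k 0)"
    by (rule infsum_cong_neutral) (auto simp: f'_def)
  also have "\<dots> = (\<Sum>\<^sub>\<infinity>k. partial_coeff c i k * multi_power x k)"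
  proof (rule infsum_reindex_bij_witness[where i = "\<lambda>k. k(i := Suc (k i))" and j = "\<lambda>k. k(i := k i - 1)"])
    fix k :: "'d \<Rightarrow> nat" assume k: "k \<in> {k. k i \<noteq> 0}"
    have "Q (k(i := k i - 1)) = Q k"
      unfolding Q_def by (rule prod.cong) auto
    then show "partial_coeff c i (k(i := k i - 1)) * multi_power x (k(i := k i - 1)) = f' k 0"
      using k by (simp add: partial_coeff_def f'_def multi_power_split[of _ _ i] Q_def)
  qed auto
  finally show ?thesis .
qed

end

section \<open>Differentiability of the gradient on the torus\<close>

lemma translate_translate: "translate (translate q a) b = translate q (a + b)"
  by transfer (simp add: add.assoc)

text \<open>Near \<open>q\<close> each partial derivative of \<open>V\<close> is again a power
  series centred at \<open>q\<close>, so differentiability at the centre of a series is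
  enough.\<close>

lemma torus_analytic_grad_differentiable:
  fixes V :: "('d::finite) torus \<Rightarrow> real"
  assumes "torus_analytic V"
  shows "(\<lambda>h. \<alpha> \<bullet> torus_grad V (translate q h)) differentiable at 0"
proof -
  obtain r c where r: "r > 0"
    and V: "\<And>h. norm h < r \<Longrightarrow> ((\<lambda>k. c k * multi_power h k) has_sum V (translate q h)) UNIV"
    using assms unfolding torus_analytic_def multi_power_def by blast
  \<comment> \<open>With this choice the cube of half-side \<open>\<rho>\<close> lies in the ball of
    radius \<open>r\<close>, since the Euclidean norm is at most the sum of the absolute
    coordinates.\<close>
  define \<rho> where "\<rho> = r / (real CARD('d) + 1)"
  have \<rho>: "\<rho> > 0" using r by (simp add: \<rho>_def add_nonneg_pos)
  have box: "norm h < r" if "\<And>i. \<bar>h $ i\<bar> \<le> \<rho>" for h :: "real^'d"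
  proof -
    have "norm h \<le> (\<Sum>i\<in>UNIV. \<bar>h $ i\<bar>)"
      by (rule norm_le_l1_cart)
    also have "\<dots> \<le> real CARD('d) * \<rho>"
      using that by (rule sum_bounded_above)
    also have "\<dots> < r"
      using r by (simp add: \<rho>_def field_simps)
    finally show ?thesis .
  qed
  \<comment> \<open>Convergence at the corner of the cube is absolute, as for every unordered real
    sum, and gives a majorant on the whole cube.\<close>
  have "norm (\<chi> i. \<rho> :: real^'d) < r"
    by (rule box) (use \<rho> in simp)
  then have "(\<lambda>k. c k * multi_power (\<chi> i. \<rho>) k) summable_on UNIV"
    by (rule V[THEN has_sum_imp_summable])
  then have "(\<lambda>k. norm (c k * multi_power (\<chi> i. \<rho>) k)) summable_on UNIV"
    by (rule summable_on_iff_abs_summable_on_real[THEN iffD1])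
  then have c: "(\<lambda>k. \<bar>c k\<bar> * \<rho> ^ degree_of k) summable_on UNIV"
    using \<rho> by (simp add: abs_mult abs_prod power_abs multi_power_def degree_of_def power_sum)
  have grad: "torus_grad V (translate q h) $ i = (\<Sum>\<^sub>\<infinity>k. partial_coeff c i k * multi_power h k)"
    if h: "norm h < \<rho> / 2" for h i
  proof -
    have *: "\<bar>h $ j\<bar> < \<rho> / 2" for j
      using component_le_norm_cart[of h j] h by linarith
    have "((\<lambda>t. V (translate q (h + t *\<^sub>R axis i 1))) has_field_derivative
        (\<Sum>\<^sub>\<infinity>k. partial_coeff c i k * multi_power h k)) (at 0)"
    proof (rule has_field_derivative_transform_within[OF multi_power_series_partial[OF \<rho> c *]])
      show "\<rho> / 2 > 0" "(0::real) \<in> UNIV" using \<rho> by simp_all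
      fix t :: real assume "dist t 0 < \<rho> / 2"
      then have "\<bar>(h + t *\<^sub>R axis i 1) $ j\<bar> \<le> \<rho>" for j
        using *[of j] by (cases "j = i") (auto simp: axis_def)
      from V[OF box[OF this]]
      show "(\<Sum>\<^sub>\<infinity>k. c k * multi_power (h + t *\<^sub>R axis i 1) k) = V (translate q (h + t *\<^sub>R axis i 1))"
        by (simp add: infsumI)
    qed
    then show ?thesis
      by (simp add: torus_grad_def translate_translate DERIV_imp_deriv)
  qed
  have "(\<lambda>h. \<Sum>i\<in>UNIV. \<alpha> $ i * (\<Sum>\<^sub>\<infinity>k. partial_coeff c i k * multi_power h k)) differentiable at 0"
    using \<rho> by (intro differentiable_sum ballI differentiable_mult differentiable_const finite
        multi_power_series_differentiable_at_0[OF _ partial_coeff_summable[OF \<rho> c]]) simp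
  then obtain D where "((\<lambda>h. \<Sum>i\<in>UNIV. \<alpha> $ i * (\<Sum>\<^sub>\<infinity>k. partial_coeff c i k * multi_power h k))
      has_derivative D) (at 0)"
    by (auto simp: differentiable_def)
  then have "((\<lambda>h. \<alpha> \<bullet> torus_grad V (translate q h)) has_derivative D) (at 0)"
    by (rule has_derivative_transform_within_open[where s = "ball 0 (\<rho> / 2)"])
      (use \<rho> in \<open>auto simp: inner_vec_def grad\<close>)
  then show ?thesis
    by (auto simp: differentiable_def)
qed

section \<open>Lyapunov exponents with multiplicity\<close>

lemma filter_replicate_mset:
  "filter_mset P (replicate_mset n x) = (if P x then replicate_mset n x else {#})"
  by (induction n) auto

text \<open>Injectivity keeps the norms of images of nonzero vectors positive, so every logarithm in
  \<open>growth\<close> is taken of a positive number.\<close>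

locale convergent_cocycle =
  fixes A :: "nat \<Rightarrow> 'a::euclidean_space \<Rightarrow> 'a"
  assumes linear: "linear (A n)"
    and inj: "inj (A n)"
    and convergent: "w \<noteq> 0 \<Longrightarrow> convergent (growth A w)"
begin

lemma norm_pos: "w \<noteq> 0 \<Longrightarrow> norm (A n w) > 0"
  using linear_injective_0[OF linear[of n]] inj[of n] by auto

lemma growth_tendsto: "w \<noteq> 0 \<Longrightarrow> growth A w \<longlonglongrightarrow> lyap_exponent A w"
  unfolding lyap_exponent_def by (metis convergent convergent_LIMSEQ_iff)

lemma exponent_scaleR:
  assumes "w \<noteq> 0" "c \<noteq> 0"
  shows "lyap_exponent A (c *\<^sub>R w) = lyap_exponent A w"
proof (rule LIMSEQ_unique[OF growth_tendsto])
  have "growth A (c *\<^sub>R w) n = ln \<bar>c\<bar> / real n + growth A w n" for n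
    using norm_pos[OF assms(1)] assms(2)
    by (simp add: growth_def linear_cmul[OF linear] ln_mult add_divide_distrib)
  then have "growth A (c *\<^sub>R w) = (\<lambda>n. ln \<bar>c\<bar> / real n + growth A w n)"
    by blast
  moreover have "(\<lambda>n. ln \<bar>c\<bar> / real n + growth A w n) \<longlonglongrightarrow> 0 + lyap_exponent A w"
    by (intro tendsto_add lim_const_over_n growth_tendsto assms)
  ultimately show "growth A (c *\<^sub>R w) \<longlonglongrightarrow> lyap_exponent A w"
    by simp
qed (use assms in simp)

text \<open>The norm of a sum is at most twice the larger norm, and the factor 2 costs only
  \<open>ln 2 / n\<close>, which tends to 0.\<close>

lemma exponent_add:
  assumes "v \<noteq> 0" "w \<noteq> 0" "v + w \<noteq> 0"
  shows "lyap_exponent A (v + w) \<le> max (lyap_exponent A v) (lyap_exponent A w)"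
proof (rule LIMSEQ_le[OF growth_tendsto[OF assms(3)]])
  show "(\<lambda>n. ln 2 / real n + max (growth A v n) (growth A w n))
      \<longlonglongrightarrow> max (lyap_exponent A v) (lyap_exponent A w)"
    using tendsto_add[OF lim_const_over_n[of "ln 2 :: real"]
        tendsto_max[OF growth_tendsto[OF assms(1)] growth_tendsto[OF assms(2)]]] by simp
  have "growth A (v + w) n \<le> ln 2 / real n + max (growth A v n) (growth A w n)" for n
  proof -
    let ?m = "max (norm (A n v)) (norm (A n w))"
    have m: "?m > 0" using norm_pos[OF assms(1), of n] by (simp only: less_max_iff_disj) simp
    have "norm (A n (v + w)) \<le> 2 * ?m"
      using norm_triangle_ineq[of "A n v" "A n w"] by (simp add: linear_add[OF linear])
    then have "ln (norm (A n (v + w))) \<le> ln (2 * ?m)"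
      using norm_pos[OF assms(3), of n] m by (subst ln_le_cancel_iff) auto
    also have "\<dots> = ln 2 + max (ln (norm (A n v))) (ln (norm (A n w)))"
      using norm_pos[OF assms(1), of n] norm_pos[OF assms(2), of n] m
      by (simp add: ln_mult) (simp add: max_def)
    finally show ?thesis
      unfolding growth_def
      \<comment> \<open>For \<open>n = 0\<close> both sides are 0, because division by zero yields
        0.\<close>
      by (cases "n = 0") (auto simp: field_simps max_def split: if_splits)
  qed
  then show "\<exists>N. \<forall>n\<ge>N. growth A (v + w) n \<le> ln 2 / real n + max (growth A v n) (growth A w n)"
    by blast
qed

text \<open>A constant lower bound contributes \<open>ln c / n\<close>, which tends to 0.\<close>

lemma exponent_ge:
  assumes "w \<noteq> 0" "c > 0" "\<And>n. c \<le> norm (A n w)"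
  shows "lyap_exponent A w \<ge> 0"
proof (rule LIMSEQ_le[OF lim_const_over_n growth_tendsto[OF assms(1)]])
  show "\<exists>N. \<forall>n\<ge>N. ln c / real n \<le> growth A w n"
    using assms norm_pos[OF assms(1)] by (auto simp: growth_def intro!: divide_right_mono)
qed

lemma exponent_sum_ge:
  assumes "v \<noteq> 0" "w \<noteq> 0" "c > 0" "\<And>n. c \<le> norm (A n v) * norm (A n w)"
  shows "lyap_exponent A v + lyap_exponent A w \<ge> 0"
proof (rule LIMSEQ_le[OF lim_const_over_n])
  show "(\<lambda>n. growth A v n + growth A w n) \<longlonglongrightarrow> lyap_exponent A v + lyap_exponent A w"
    by (intro tendsto_add growth_tendsto assms)
  have "ln c / real n \<le> growth A v n + growth A w n" for n
  proof -
    have "ln c \<le> ln (norm (A n v) * norm (A n w))"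
      using assms norm_pos[OF assms(1), of n] norm_pos[OF assms(2), of n] by simp
    also have "\<dots> = ln (norm (A n v)) + ln (norm (A n w))"
      using norm_pos[OF assms(1), of n] norm_pos[OF assms(2), of n] by (simp add: ln_mult)
    finally show ?thesis
      unfolding growth_def add_divide_distrib[symmetric] by (rule divide_right_mono) simp
  qed
  then show "\<exists>N. \<forall>n\<ge>N. ln c / real n \<le> growth A v n + growth A w n"
    by blast
qed

text \<open>Scaling keeps an exponent and a sum does not exceed the larger one. An arbitrary
  down-closed \<open>I\<close> covers both the weak and the strict sublevel sets in
  \<open>lyap_multiplicity\<close>.\<close>

lemma subspace_filtration:
  assumes "\<And>x y. x \<in> I \<Longrightarrow> y \<le> x \<Longrightarrow> y \<in> I"
  shows "subspace {w. w = 0 \<or> lyap_exponent A w \<in> I}"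
proof (rule subspaceI)
  fix v w assume "v \<in> {w. w = 0 \<or> lyap_exponent A w \<in> I}" "w \<in> {w. w = 0 \<or> lyap_exponent A w \<in> I}"
  then show "v + w \<in> {w. w = 0 \<or> lyap_exponent A w \<in> I}"
    using exponent_add[of v w] unfolding le_max_iff_disj
    by (cases "v = 0"; cases "w = 0") (simp_all, blast intro: assms)
next
  fix c w assume "w \<in> {w. w = 0 \<or> lyap_exponent A w \<in> I}"
  then show "c *\<^sub>R w \<in> {w. w = 0 \<or> lyap_exponent A w \<in> I}"
    using exponent_scaleR[of w c] by (cases "c = 0 \<or> w = 0") auto
qed auto

lemmas subspace_le = subspace_filtration[of "{..\<mu>}" for \<mu>, simplified]
lemmas subspace_less = subspace_filtration[of "{..<\<mu>}" for \<mu>, simplified]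

text \<open>The vector \<open>w\<close> itself separates the two subspaces, so every attained
  exponent has positive multiplicity.\<close>

lemma dim_less_le:
  assumes "w \<noteq> 0"
  shows "dim {v. v = 0 \<or> lyap_exponent A v < lyap_exponent A w}
    < dim {v. v = 0 \<or> lyap_exponent A v \<le> lyap_exponent A w}"
proof (rule dim_psubset)
  have "w \<notin> {v. v = 0 \<or> lyap_exponent A v < lyap_exponent A w}" "w \<in> {v. v = 0 \<or> lyap_exponent A v \<le> lyap_exponent A w}"
    using assms by auto
  then have "{v. v = 0 \<or> lyap_exponent A v < lyap_exponent A w}
    \<subset> {v. v = 0 \<or> lyap_exponent A v \<le> lyap_exponent A w}" by force
  then show "span {v. v = 0 \<or> lyap_exponent A v < lyap_exponent A w}
    \<subset> span {v. v = 0 \<or> lyap_exponent A v \<le> lyap_exponent A w}"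
    by (simp add: span_eq_iff[THEN iffD2] subspace_le subspace_less)
qed

text \<open>The dimension of the sublevel space grows strictly from one attained exponent to the
  next, which injects the exponents into the numbers up to \<open>DIM('a)\<close>.\<close>

lemma finite_exponents: "finite (lyap_exponent A ` (- {0}))"
proof (rule inj_on_finite)
  let ?d = "\<lambda>\<mu>. dim {v. v = 0 \<or> lyap_exponent A v \<le> \<mu>}"
  have less: "?d \<mu> < ?d \<nu>" if "\<mu> < \<nu>" "\<nu> \<in> lyap_exponent A ` (- {0})" for \<mu> \<nu>
  proof -
    have "?d \<mu> \<le> dim {v. v = 0 \<or> lyap_exponent A v < \<nu>}"
      using that by (intro dim_subset) auto
    also have "\<dots> < ?d \<nu>"
      using that dim_less_le by auto
    finally show ?thesis .
  qed
  show "inj_on ?d (lyap_exponent A ` (- {0}))"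
    by (rule linorder_inj_onI', rule less_imp_neq, rule less)
  show "?d ` (lyap_exponent A ` (- {0})) \<subseteq> {..DIM('a)}"
    using dim_subset_UNIV by auto
qed simp

text \<open>The jumps of dimension telescope along an initial segment \<open>Y\<close> of the
  attained exponents; the induction adds the largest element last.\<close>

lemma sum_multiplicity:
  assumes "finite Y" "Y \<subseteq> lyap_exponent A ` (- {0})"
    "\<And>x y. x \<in> Y \<Longrightarrow> y \<in> lyap_exponent A ` (- {0}) \<Longrightarrow> y \<le> x \<Longrightarrow> y \<in> Y"
  shows "(\<Sum>\<mu>\<in>Y. lyap_multiplicity A \<mu>) = dim {w. w = 0 \<or> lyap_exponent A w \<in> Y}"
  using assms
proof (induction rule: finite_linorder_max_induct)
  case empty
  then show ?case by simp
next
  case (insert \<mu> Y)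
  have IH: "(\<Sum>\<mu>\<in>Y. lyap_multiplicity A \<mu>) = dim {w. w = 0 \<or> lyap_exponent A w \<in> Y}"
  proof (rule insert.IH)
    fix x y assume xy: "x \<in> Y" "y \<in> lyap_exponent A ` (- {0})" "y \<le> x"
    then have "y \<in> insert \<mu> Y"
      using insert.prems(2)[of x y] by blast
    moreover have "y < \<mu>" using xy insert.hyps(2) by force
    ultimately show "y \<in> Y" by blast
  qed (use insert.prems in auto)
  have *: "x \<in> Y \<longleftrightarrow> x < \<mu>" "x \<in> insert \<mu> Y \<longleftrightarrow> x \<le> \<mu>" if "x \<in> lyap_exponent A ` (- {0})" for x
    \<comment> \<open>Among attained values, \<open>Y\<close> is exactly what lies below
      \<open>\<mu>\<close>, since \<open>insert \<mu> Y\<close> is an initial segment with maximum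
      \<open>\<mu>\<close>.\<close>
    using insert.prems(2)[of \<mu> x] insert.hyps(2) that by (auto simp: le_less)
  have "{w. w = 0 \<or> lyap_exponent A w \<in> Y} = {w. w = 0 \<or> lyap_exponent A w < \<mu>}"
    "{w. w = 0 \<or> lyap_exponent A w \<in> insert \<mu> Y} = {w. w = 0 \<or> lyap_exponent A w \<le> \<mu>}"
    using *(1) *(2) by blast+
  \<comment> \<open>The multiplicity is a truncated difference of naturals, so telescoping requires
    this inequality.\<close>
  moreover have "dim {w. w = 0 \<or> lyap_exponent A w < \<mu>} \<le> dim {w. w = 0 \<or> lyap_exponent A w \<le> \<mu>}"
    by (intro dim_subset) auto
  ultimately show ?case
    using insert.hyps IH by (subst sum.insert) (auto simp: lyap_multiplicity_def)
qed

text \<open>This turns counting exponents into computing dimensions: \<open>I = UNIV\<close> gives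
  their total number, and the open negative half-line gives the number of negative ones.\<close>

lemma size_filter_exponents:
  assumes "\<And>x y. x \<in> I \<Longrightarrow> y \<le> x \<Longrightarrow> y \<in> I"
  shows "size (filter_mset (\<lambda>x. x \<in> I) (lyap_exponents A)) = dim {w. w = 0 \<or> lyap_exponent A w \<in> I}"
proof -
  let ?X = "lyap_exponent A ` (- {0})"
  have "filter_mset (\<lambda>x. x \<in> I) (\<Sum>\<mu>\<in>Y. replicate_mset (lyap_multiplicity A \<mu>) \<mu>)
      = (\<Sum>\<mu>\<in>Y \<inter> I. replicate_mset (lyap_multiplicity A \<mu>) \<mu>)" if "finite Y" for Y
    using that by (induction Y) (auto simp: Int_insert_left filter_replicate_mset)
  then have "size (filter_mset (\<lambda>x. x \<in> I) (lyap_exponents A)) = (\<Sum>\<mu>\<in>?X \<inter> I. lyap_multiplicity A \<mu>)"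
    unfolding lyap_exponents_def using finite_exponents by simp
  also have "\<dots> = dim {w. w = 0 \<or> lyap_exponent A w \<in> ?X \<inter> I}"
    using finite_exponents assms by (intro sum_multiplicity) auto
  also have "{w. w = 0 \<or> lyap_exponent A w \<in> ?X \<inter> I} = {w. w = 0 \<or> lyap_exponent A w \<in> I}"
    by auto
  finally show ?thesis .
qed

lemma size_exponents: "size (lyap_exponents A) = DIM('a)"
  using size_filter_exponents[of UNIV] by simp

lemma exponent_in_exponents:
  assumes "w \<noteq> 0"
  shows "lyap_exponent A w \<in># lyap_exponents A"
proof -
  have "lyap_multiplicity A (lyap_exponent A w) > 0"
    using dim_less_le[OF assms] by (simp add: lyap_multiplicity_def)
  then have "lyap_exponent A w \<in># replicate_mset (lyap_multiplicity A (lyap_exponent A w)) (lyap_exponent A w)"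
    by (simp add: in_replicate_mset)
  then show ?thesis
    unfolding lyap_exponents_def using assms
    by (subst set_mset_sum[OF finite_exponents]) (rule UN_I[OF imageI], auto)
qed

lemma in_exponentsD:
  assumes "x \<in># lyap_exponents A"
  shows "\<exists>v. v \<noteq> 0 \<and> x = lyap_exponent A v"
proof -
  obtain \<mu> where "\<mu> \<in> lyap_exponent A ` (- {0})" "x \<in># replicate_mset (lyap_multiplicity A \<mu>) \<mu>"
    using assms unfolding lyap_exponents_def set_mset_sum[OF finite_exponents] by blast
  then show ?thesis by (auto split: if_splits)
qed

end

text \<open>If there is a negative entry, remove it together with its partner. The remaining entries
  are nonnegative and their sum is at most 0, so they all vanish.\<close>

lemma count_zero_of_sum_zero:
  fixes L :: "real multiset"
  assumes sum: "sum_mset L = 0"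
    and neg: "size (filter_mset (\<lambda>x. x < 0) L) \<le> 1"
    and pair: "\<And>x. x \<in># L \<Longrightarrow> x < 0 \<Longrightarrow> \<exists>y. y \<in># L \<and> x + y \<ge> 0"
  shows "size L \<le> count L 0 + 2"
proof -
  have zero: "count M 0 = size M" if "\<And>x. x \<in># M \<Longrightarrow> x \<ge> 0" "sum_mset M \<le> 0" for M :: "real multiset"
    using that
  proof (induction M)
    case (add x M)
    have "sum_mset M \<ge> 0"
      using add.prems(1) sum_mset_mono[of M "\<lambda>_. 0" "\<lambda>x. x"] by simp
    moreover have "x \<ge> 0" using add.prems(1) by simp
    ultimately have "x = 0" "sum_mset M \<le> 0" using add.prems(2) by auto
    with add show ?case by simp
  qed simp
  show ?thesis
  proof (cases "\<exists>x\<in>#L. x < 0")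
    case True
    then obtain x where x: "x \<in># L" "x < 0" by blast
    then obtain y where y: "y \<in># L" "x + y \<ge> 0" using pair by blast
    \<comment> \<open>The partner satisfies \<open>y \<ge> - x > 0\<close>, so it is a separate
      entry of the multiset.\<close>
    then have "x \<noteq> y" using x by auto
    then obtain M where L: "L = add_mset x (add_mset y M)"
      using x(1) y(1) by (metis insert_noteq_member multi_member_split)
    have "z \<ge> 0" if "z \<in># M" for z
    proof (rule ccontr)
      assume "\<not> z \<ge> 0"
      then have "z \<in># filter_mset (\<lambda>x. x < 0) M" using that by simp
      then have "size (filter_mset (\<lambda>x. x < 0) M) \<noteq> 0" by auto
      then show False using neg x(2) by (simp add: L split: if_splits)
    qed
    moreover have "sum_mset M \<le> 0" using sum y by (simp add: L)
    ultimately have "count M 0 = size M" by (rule zero)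
    then show ?thesis by (simp add: L)
  next
    case False
    then have "count L 0 = size L" using sum by (intro zero) (auto simp: not_less)
    then show ?thesis by simp
  qed
qed

section \<open>The derivative cocycle\<close>

text \<open>The chain rule, read in the charts around \<open>z\<close>, \<open>G z\<close> and
  \<open>H (G z)\<close>.\<close>

lemma has_phase_derivative_comp:
  assumes "has_phase_derivative G D z" "has_phase_derivative H E (G z)"
  shows "has_phase_derivative (H \<circ> G) (E \<circ> D) z"
proof -
  obtain g where g: "(g has_derivative D) (at 0)" "g 0 = 0"
    "\<forall>\<^sub>F w in nhds 0. G (move z w) = move (G z) (g w)"
    using assms(1) unfolding has_phase_derivative_def by blast
  obtain h where h: "(h has_derivative E) (at 0)" "h 0 = 0"
    "\<forall>\<^sub>F w in nhds 0. H (move (G z) w) = move (H (G z)) (h w)"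
    using assms(2) unfolding has_phase_derivative_def by blast
  have "(h \<circ> g has_derivative E \<circ> D) (at 0)"
    using g(1) h(1) g(2) by (metis diff_chain_at)
  moreover have "\<forall>\<^sub>F w in nhds 0. H (move (G z) (g w)) = move (H (G z)) (h (g w))"
  proof -
    \<comment> \<open>The chart identity for \<open>H\<close> holds only near 0; continuity of
      \<open>g\<close> with \<open>g 0 = 0\<close> pulls it back to small \<open>w\<close>.\<close>
    have "filterlim g (nhds 0) (nhds 0)"
      using has_derivative_continuous[OF g(1)] g(2)
      unfolding isCont_def tendsto_at_iff_tendsto_nhds by simp
    then show ?thesis using h(3) by (rule eventually_compose_filterlim[rotated])
  qed
  then have "\<forall>\<^sub>F w in nhds 0. (H \<circ> G) (move z w) = move ((H \<circ> G) z) ((h \<circ> g) w)"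
    using g(3) by eventually_elim simp
  ultimately show ?thesis
    unfolding has_phase_derivative_def using g(2) h(2) by (intro exI[of _ "h \<circ> g"]) simp
qed

lemma has_phase_derivative_id: "has_phase_derivative id id z"
  unfolding has_phase_derivative_def by (intro exI[of _ id]) (simp add: has_derivative_ident id_def)

lemma phase_derivative_eq: "has_phase_derivative G D z \<Longrightarrow> phase_derivative G z = D"
  unfolding phase_derivative_def by (rule the_equality) (auto intro: has_phase_derivative_unique)

section \<open>Determinants on the tangent space\<close>

lemma det_shear:
  assumes "x $ k = 0"
  shows "det (\<chi> i. if i = k then axis k 1 + x else axis i 1 :: real ^ 'n ^ 'n) = 1"
proof -
  have row: "row i (mat 1 :: real ^ 'n ^ 'n) = axis i 1" for i
    by (simp add: row_def mat_def axis_def vec_eq_iff)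
  have "x = (\<Sum>i\<in>UNIV. x $ i *s axis i 1)"
    by (simp add: basis_expansion)
  \<comment> \<open>Since \<open>x $ k = 0\<close>, the vector \<open>x\<close> combines only the
    other rows of the identity matrix, and adding it to row \<open>k\<close> leaves the determinant
    unchanged.\<close>
  also have "\<dots> = (\<Sum>i\<in>UNIV - {k}. x $ i *s axis i 1)"
    using assms by (simp add: sum.remove[of UNIV k])
  also have "\<dots> \<in> vec.span {row j (mat 1 :: real ^ 'n ^ 'n) |j. j \<noteq> k}"
    by (intro vec.span_sum vec.span_scale vec.span_base) (auto simp: row)
  finally have "det (\<chi> i. if i = k then row k (mat 1) + x else row i (mat 1)) = det (mat 1 :: real ^ 'n ^ 'n)"
    by (rule det_row_span)
  then show ?thesis by (simp only: row det_I)
qed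

lemma of_vec_to_vec: "of_vec (to_vec w) = w"
  by (simp add: of_vec_def to_vec_def prod_eq_iff vec_eq_iff)

lemma linear_to_vec: "linear to_vec"
  by (rule linearI) (simp_all add: to_vec_def vec_eq_iff split: option.split)

lemma linear_of_vec: "linear of_vec"
  by (rule linearI) (simp_all add: of_vec_def vec_eq_iff prod_eq_iff)

lemma phase_det_comp:
  assumes "linear A" "linear B"
  shows "phase_det (A \<circ> B) = phase_det A * phase_det B"
proof -
  have "to_vec \<circ> (A \<circ> B) \<circ> of_vec = (to_vec \<circ> A \<circ> of_vec) \<circ> (to_vec \<circ> B \<circ> of_vec)"
    by (simp add: fun_eq_iff of_vec_to_vec)
  then show ?thesis
    unfolding phase_det_def using assms
    by (simp add: matrix_compose linear_compose linear_to_vec linear_of_vec det_mul)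
qed

lemma phase_det_id: "phase_det (id :: real \<times> (real ^ ('d::finite)) \<Rightarrow> _) = 1"
proof -
  have "to_vec \<circ> id \<circ> of_vec = (id :: real ^ 'd option \<Rightarrow> _)"
    by (simp add: fun_eq_iff of_vec_def to_vec_def vec_eq_iff split: option.split)
  then show ?thesis by (simp only: phase_det_def matrix_id_mat_1 det_I)
qed

lemma phase_det_shear_fst:
  fixes \<psi> :: "real ^ ('d::finite) \<Rightarrow> real"
  assumes "linear \<psi>"
  shows "phase_det (\<lambda>w. (fst w - \<psi> (snd w), snd w)) = 1"
proof -
  let ?x = "\<chi> j. case j of None \<Rightarrow> 0 | Some j \<Rightarrow> - \<psi> (axis j 1)"
  have zero: "(\<chi> j. 0) = (0 :: real ^ 'd)" by (simp add: vec_eq_iff)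
  have ax: "(\<chi> j. if j = l then 1 else 0) = (axis l 1 :: real ^ 'd)" for l
    by (simp add: vec_eq_iff axis_def)
  have "matrix (to_vec \<circ> (\<lambda>w. (fst w - \<psi> (snd w), snd w)) \<circ> of_vec)
      = (\<chi> i. if i = None then axis None 1 + ?x else axis i 1)"
    by (auto simp: vec_eq_iff matrix_def to_vec_def of_vec_def axis_def[of None] axis_def[of "Some _"] ax zero linear_0[OF assms]
        split: option.split)
  then show ?thesis
    unfolding phase_det_def by (simp add: det_shear)
qed

lemma phase_det_shear_snd:
  fixes \<alpha> :: "real ^ ('d::finite)"
  shows "phase_det (\<lambda>w. (fst w, snd w + fst w *\<^sub>R \<alpha>)) = 1"
proof -
  let ?x = "\<chi> j. case j of None \<Rightarrow> 0 | Some j \<Rightarrow> \<alpha> $ j"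
  \<comment> \<open>Here the column of \<open>None\<close> changes instead of its row, hence the
    transpose.\<close>
  have "matrix (to_vec \<circ> (\<lambda>w. (fst w, snd w + fst w *\<^sub>R \<alpha>)) \<circ> of_vec)
      = transpose (\<chi> i. if i = None then axis None 1 + ?x else axis i 1)"
    by (auto simp: vec_eq_iff matrix_def transpose_def to_vec_def of_vec_def axis_def split: option.split)
  then show ?thesis
    unfolding phase_det_def by (simp add: det_transpose det_shear)
qed

text \<open>On the plane \<open>\<real> \<times> \<real>\<alpha>\<close> this is \<open>\<alpha> \<bullet> \<alpha>\<close> times the determinant in the basis
  \<open>(1, 0), (0, \<alpha>)\<close>.\<close>

definition area :: "real ^ ('d::finite) \<Rightarrow> real \<times> (real ^ ('d::finite)) \<Rightarrow> real \<times> (real ^ 'd) \<Rightarrow> real" where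
  "area \<alpha> v w = fst v * (\<alpha> \<bullet> snd w) - fst w * (\<alpha> \<bullet> snd v)"

text \<open>These properties pass to compositions, so they reach all iterates from a single step.
  Area is compared only on the plane over \<open>span {\<alpha>}\<close>; the span condition says
  that \<open>A\<close> is the identity modulo that plane.\<close>

definition preserves_structure :: "real ^ ('d::finite) \<Rightarrow> (real \<times> (real ^ ('d::finite)) \<Rightarrow> real \<times> (real ^ 'd)) \<Rightarrow> bool" where
  "preserves_structure \<alpha> A \<longleftrightarrow> linear A \<and> inj A \<and> phase_det A = 1 \<and>
     (\<forall>w. snd (A w) - snd w \<in> span {\<alpha>}) \<and>
     (\<forall>v w. snd v \<in> span {\<alpha>} \<longrightarrow> snd w \<in> span {\<alpha>} \<longrightarrow> area \<alpha> (A v) (A w) = area \<alpha> v w)"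

lemma
  assumes "preserves_structure \<alpha> A"
  shows preserves_structure_linear: "linear A"
    and preserves_structure_inj: "inj A"
    and preserves_structure_det: "phase_det A = 1"
    and preserves_structure_span: "snd (A w) - snd w \<in> span {\<alpha>}"
    and preserves_structure_area:
      "snd v \<in> span {\<alpha>} \<Longrightarrow> snd w \<in> span {\<alpha>} \<Longrightarrow> area \<alpha> (A v) (A w) = area \<alpha> v w"
  using assms unfolding preserves_structure_def by blast+

lemma preserves_structure_id: "preserves_structure \<alpha> id"
  by (simp add: preserves_structure_def phase_det_id linear_id span_zero)

lemma preserves_structure_comp:
  assumes A: "preserves_structure \<alpha> A" and B: "preserves_structure \<alpha> B"
  shows "preserves_structure \<alpha> (A \<circ> B)"
proof -
  have "snd (A (B w)) - snd w \<in> span {\<alpha>}" for w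
    using span_add[OF preserves_structure_span[OF A, of "B w"] preserves_structure_span[OF B, of w]]
    by simp
  \<comment> \<open>\<open>B\<close> keeps the plane invariant, so the area identity of
    \<open>A\<close> applies to images under \<open>B\<close>.\<close>
  moreover have "snd (B w) \<in> span {\<alpha>}" if "snd w \<in> span {\<alpha>}" for w
    using span_add[OF preserves_structure_span[OF B, of w] that] by simp
  ultimately show ?thesis
    using A B unfolding preserves_structure_def[of _ "A \<circ> B"]
    by (auto simp: preserves_structure_linear preserves_structure_inj preserves_structure_det
        preserves_structure_area linear_compose inj_compose phase_det_comp simp del: split_paired_All)
qed

text \<open>The map is a shear of the first factor along \<open>\<psi>\<close> followed by a shear
  of the second along \<open>\<alpha>\<close>, each of determinant 1.\<close>

lemma preserves_structure_step:
  assumes "linear \<psi>"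
  shows "preserves_structure \<alpha> (\<lambda>w. (fst w - \<psi> (snd w), snd w + (fst w - \<psi> (snd w)) *\<^sub>R \<alpha>))"
    (is "preserves_structure \<alpha> ?D")
proof -
  interpret \<psi>: linear \<psi> by fact
  let ?S = "\<lambda>w. (fst w - \<psi> (snd w), snd w)" and ?T = "\<lambda>w. (fst w, snd w + fst w *\<^sub>R \<alpha>)"
  have D: "?D = ?T \<circ> ?S" by (simp add: fun_eq_iff)
  have S: "linear ?S"
    by (rule linearI) (simp_all add: \<psi>.add \<psi>.scale prod_eq_iff algebra_simps)
  have T: "linear ?T"
    by (rule linearI) (simp_all add: prod_eq_iff algebra_simps)
  have "linear ?D" unfolding D using S T by (rule linear_compose)
  moreover have "phase_det ?D = 1"
    unfolding D using S T by (simp add: phase_det_comp phase_det_shear_fst[OF assms] phase_det_shear_snd)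
  moreover have "inj ?D" by (rule injI) (auto simp: prod_eq_iff)
  moreover have "area \<alpha> (?D v) (?D w) = area \<alpha> v w"
    if v: "snd v \<in> span {\<alpha>}" and w: "snd w \<in> span {\<alpha>}" for v w
  proof -
    \<comment> \<open>For multiples of \<open>\<alpha>\<close> the two contributions of
      \<open>\<psi>\<close> to the area cancel by linearity.\<close>
    obtain s t where "snd v = s *\<^sub>R \<alpha>" "snd w = t *\<^sub>R \<alpha>"
      using v w by (auto simp: span_singleton)
    then show ?thesis by (simp add: area_def \<psi>.scale algebra_simps)
  qed
  ultimately show ?thesis
    unfolding preserves_structure_def by (simp add: span_scale span_base)
qed

lemma F_map_phase_derivative:
  assumes "torus_analytic V"
  shows "\<exists>D. has_phase_derivative (F_map V \<alpha> \<epsilon> lam) D z \<and> preserves_structure \<alpha> D"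
proof -
  obtain p q where z: "z = (p, q)" by fastforce
  have translate_0: "translate q 0 = q" for q by transfer simp
  define \<Phi> where "\<Phi> h = \<alpha> \<bullet> torus_grad V (translate q h)" for h
  obtain \<psi> where \<psi>: "(\<Phi> has_derivative \<psi>) (at 0)"
    using torus_analytic_grad_differentiable[OF assms, of \<alpha> q]
    unfolding \<Phi>_def[abs_def] differentiable_def by blast
  \<comment> \<open>\<open>b w\<close> is the change of the new momentum when the point moves by
    \<open>w\<close>. The resulting chart expression of the map is exact for every \<open>w\<close>,
    not only for small ones.\<close>
  define b where "b w = fst w - \<epsilon> * (\<Phi> (snd w) - \<Phi> 0)" for w
  let ?D = "\<lambda>w. (fst w - \<epsilon> * \<psi> (snd w), snd w + (fst w - \<epsilon> * \<psi> (snd w)) *\<^sub>R \<alpha>)"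
  have b: "(b has_derivative (\<lambda>w. fst w - \<epsilon> * \<psi> (snd w))) (at 0)"
  proof -
    have "((\<lambda>w. \<Phi> (snd w)) has_derivative (\<lambda>w. \<psi> (snd w))) (at 0)"
      using \<psi> by (intro has_derivative_compose[OF has_derivative_snd[OF has_derivative_ident]]) simp
    then show ?thesis
      unfolding b_def[abs_def] by (auto intro!: derivative_eq_intros)
  qed
  have "has_phase_derivative (F_map V \<alpha> \<epsilon> lam) ?D z"
    unfolding has_phase_derivative_def
  proof (intro exI conjI always_eventually allI)
    show "((\<lambda>w. (b w, snd w + b w *\<^sub>R \<alpha>)) has_derivative ?D) (at 0)"
      by (intro has_derivative_Pair b has_derivative_add has_derivative_snd has_derivative_ident
          has_derivative_scaleR_left)
    show "(b 0, snd 0 + b 0 *\<^sub>R \<alpha>) = 0" by (simp add: b_def zero_prod_def)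
    show "F_map V \<alpha> \<epsilon> lam (move z w) = move (F_map V \<alpha> \<epsilon> lam z) (b w, snd w + b w *\<^sub>R \<alpha>)" for w
      by (simp add: F_map_def move_def z Let_def case_prod_unfold b_def \<Phi>_def translate_translate
          translate_0 algebra_simps)
  qed
  moreover have "preserves_structure \<alpha> ?D"
    using preserves_structure_step[OF linear_compose_scale_right[OF has_derivative_linear[OF \<psi>], of \<epsilon>], of \<alpha>] by simp
  ultimately show ?thesis by blast
qed

text \<open>\<open>phase_derivative\<close> is a definite description, so a derivative of the
  iterate is first built by induction with the chain rule and then identified by uniqueness.\<close>

lemma derivative_cocycle_preserves_structure:
  assumes "torus_analytic V"
  shows "preserves_structure \<alpha> (derivative_cocycle (F_map V \<alpha> \<epsilon> lam) z n)"
proof -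
  have "\<exists>D. has_phase_derivative (F_map V \<alpha> \<epsilon> lam ^^ n) D z \<and> preserves_structure \<alpha> D"
  proof (induction n)
    case 0
    show ?case
      using has_phase_derivative_id[of z] preserves_structure_id[of \<alpha>] by (auto simp: id_def)
  next
    case (Suc n)
    then show ?case
      using F_map_phase_derivative[OF assms] has_phase_derivative_comp preserves_structure_comp
      unfolding funpow.simps by metis
  qed
  then show ?thesis
    unfolding derivative_cocycle_def using phase_derivative_eq by metis
qed

text \<open>By Cauchy-Schwarz; it turns invariance of the area into a lower bound on a product of
  norms.\<close>

lemma area_le: "\<bar>area \<alpha> v w\<bar> \<le> 2 * norm \<alpha> * (norm v * norm w)"
proof -
  have "\<bar>fst v * (\<alpha> \<bullet> snd w)\<bar> \<le> norm \<alpha> * (norm v * norm w)" for v w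
  proof -
    have "\<bar>\<alpha> \<bullet> snd w\<bar> \<le> norm \<alpha> * norm w"
      using Cauchy_Schwarz_ineq2[of \<alpha> "snd w"] norm_snd_le[of "snd w" "fst w"]
      by (simp, meson mult_left_mono norm_ge_zero order_trans)
    moreover have "\<bar>fst v\<bar> \<le> norm v"
      using norm_fst_le[of "fst v" "snd v"] by simp
    ultimately have "\<bar>fst v\<bar> * \<bar>\<alpha> \<bullet> snd w\<bar> \<le> norm v * (norm \<alpha> * norm w)"
      by (intro mult_mono) auto
    then show ?thesis by (simp add: abs_mult ac_simps)
  qed
  from this[of v w] this[of w v] show ?thesis
    unfolding area_def by (simp add: ac_simps)
qed

lemma area_eq_0_imp_span:
  assumes "\<alpha> \<noteq> 0" "snd v \<in> span {\<alpha>}" "snd w \<in> span {\<alpha>}" "v \<noteq> 0" "area \<alpha> v w = 0"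
  shows "w \<in> span {v}"
proof -
  obtain s t where st: "snd v = s *\<^sub>R \<alpha>" "snd w = t *\<^sub>R \<alpha>"
    using assms by (auto simp: span_singleton)
  have eq: "fst v * t = fst w * s"
    using assms by (simp add: area_def st)
  have "\<exists>c. w = c *\<^sub>R v"
  proof (cases "fst v = 0")
    case True
    then have "s \<noteq> 0" using assms(4) st by (auto simp: prod_eq_iff)
    then show ?thesis using True eq st
      by (intro exI[of _ "t / s"]) (simp add: prod_eq_iff)
  next
    case False
    then show ?thesis using eq st
      by (intro exI[of _ "fst w / fst v"]) (auto simp: prod_eq_iff field_simps)
  qed
  then show ?thesis by (auto simp: span_singleton)
qed

lemma area_nondegenerate:
  assumes "\<alpha> \<noteq> 0" "snd v \<in> span {\<alpha>}" "v \<noteq> 0"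
  obtains w where "snd w \<in> span {\<alpha>}" "area \<alpha> v w \<noteq> 0"
proof -
  obtain s where s: "snd v = s *\<^sub>R \<alpha>"
    using assms by (auto simp: span_singleton)
  \<comment> \<open>In the coordinates given by the first component and the coefficient of
    \<open>\<alpha>\<close>, this is \<open>v\<close> rotated by a quarter turn.\<close>
  let ?w = "(- s, fst v *\<^sub>R \<alpha>)"
  have "area \<alpha> v ?w = (fst v * fst v + s * s) * (\<alpha> \<bullet> \<alpha>)"
    by (simp add: area_def s algebra_simps)
  moreover have "fst v * fst v + s * s \<noteq> 0"
    using assms(3) s by (auto simp: prod_eq_iff sum_squares_eq_zero_iff)
  ultimately show thesis
    using assms(1) by (intro that[of ?w]) (auto intro: span_scale span_base)
qed

section \<open>Signs of the exponents inside and outside the plane\<close>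

locale structured_cocycle = convergent_cocycle A
  for A :: "nat \<Rightarrow> real \<times> (real ^ ('d::finite)) \<Rightarrow> real \<times> (real ^ 'd)" +
  fixes \<alpha> :: "real ^ 'd"
  assumes preserves: "preserves_structure \<alpha> (A n)" and \<alpha>: "\<alpha> \<noteq> 0"
begin

text \<open>The part \<open>u\<close> of \<open>snd w\<close> orthogonal to \<open>\<alpha>\<close>
  is the same for all images \<open>A n w\<close>, so their norms never fall below
  \<open>norm u\<close>.\<close>

lemma exponent_nonneg:
  assumes w: "snd w \<notin> span {\<alpha>}"
  shows "lyap_exponent A w \<ge> 0"
proof -
  define u where "u = snd w - (\<alpha> \<bullet> snd w / (\<alpha> \<bullet> \<alpha>)) *\<^sub>R \<alpha>"
  have "u \<noteq> 0"
    using w by (auto simp: u_def span_singleton)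
  have ortho: "u \<bullet> \<alpha> = 0"
    using \<alpha> by (simp add: u_def inner_diff_left) (simp add: inner_commute)
  have inner_u: "u \<bullet> snd w = norm u * norm u"
  proof -
    have "snd w = u + (\<alpha> \<bullet> snd w / (\<alpha> \<bullet> \<alpha>)) *\<^sub>R \<alpha>"
      by (simp add: u_def)
    then have "u \<bullet> snd w = u \<bullet> u"
      using ortho by (metis add.right_neutral inner_add_right inner_scaleR_right mult_zero_right)
    then show ?thesis by (simp add: norm_eq_sqrt_inner)
  qed
  have "norm u \<le> norm (A n w)" for n
  proof -
    obtain t where "snd (A n w) - snd w = t *\<^sub>R \<alpha>"
      using preserves_structure_span[OF preserves, of n w] unfolding span_singleton by blast
    then have "snd (A n w) = snd w + t *\<^sub>R \<alpha>" by (simp add: algebra_simps)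
    then have "norm u * norm u = u \<bullet> snd (A n w)"
      using ortho inner_u by (simp add: inner_add_right)
    also have "\<dots> \<le> norm u * norm (snd (A n w))"
      by (rule norm_cauchy_schwarz)
    finally have "norm u \<le> norm (snd (A n w))"
      using \<open>u \<noteq> 0\<close> by simp
    then show ?thesis
      using norm_snd_le[of "snd (A n w)" "fst (A n w)"] by simp
  qed
  moreover have "w \<noteq> 0" using w by (auto simp: span_zero)
  ultimately show ?thesis
    using \<open>u \<noteq> 0\<close> by (intro exponent_ge[where c = "norm u"]) auto
qed

text \<open>The area of the images is constant and is bounded by \<open>2 * norm \<alpha>\<close>
  times the product of their norms, so that product stays away from 0.\<close>

lemma exponent_add_nonneg:
  assumes "snd v \<in> span {\<alpha>}" "snd w \<in> span {\<alpha>}" "area \<alpha> v w \<noteq> 0"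
  shows "lyap_exponent A v + lyap_exponent A w \<ge> 0"
proof (rule exponent_sum_ge)
  show "\<bar>area \<alpha> v w\<bar> / (2 * norm \<alpha>) > 0"
    using assms \<alpha> by simp
  show "\<bar>area \<alpha> v w\<bar> / (2 * norm \<alpha>) \<le> norm (A n v) * norm (A n w)" for n
    using area_le[of \<alpha> "A n v" "A n w"] \<alpha>
    by (simp add: preserves_structure_area[OF preserves assms(1,2)] divide_le_eq ac_simps)
qed (use assms in \<open>auto simp: area_def\<close>)

text \<open>Vectors with negative exponents lie in the plane, and any two of them span zero area,
  hence are collinear.\<close>

lemma dim_negative_le: "dim {w. w = 0 \<or> lyap_exponent A w < 0} \<le> 1"
proof (cases "\<exists>v. v \<noteq> 0 \<and> lyap_exponent A v < 0")
  case True
  then obtain v where v: "v \<noteq> 0" "lyap_exponent A v < 0" by blast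
  have "{w. w = 0 \<or> lyap_exponent A w < 0} \<subseteq> span {v}"
  proof
    fix w assume "w \<in> {w. w = 0 \<or> lyap_exponent A w < 0}"
    then consider "w = 0" | "lyap_exponent A w < 0" by blast
    then show "w \<in> span {v}"
    proof cases
      case 2
      have *: "snd v \<in> span {\<alpha>}" "snd w \<in> span {\<alpha>}"
        using exponent_nonneg v(2) 2 by (meson not_less)+
      then have "area \<alpha> v w = 0"
        using exponent_add_nonneg v(2) 2 by fastforce
      with \<alpha> * v(1) show ?thesis by (intro area_eq_0_imp_span)
    qed (simp add: span_zero)
  qed
  then have "dim {w. w = 0 \<or> lyap_exponent A w < 0} \<le> dim {v}"
    by (rule dim_mono)
  then show ?thesis using v(1) by (simp add: dim_singleton)
next
  case False
  then have "{w. w = 0 \<or> lyap_exponent A w < 0} = {0}" by auto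
  then show ?thesis by (simp add: dim_singleton)
qed

lemma count_zero_exponents:
  assumes "sum_mset (lyap_exponents A) = 0"
  shows "size (lyap_exponents A) \<le> count (lyap_exponents A) 0 + 2"
  using assms
proof (rule count_zero_of_sum_zero)
  show "size (filter_mset (\<lambda>x. x < 0) (lyap_exponents A)) \<le> 1"
    using size_filter_exponents[of "{..<0}"] dim_negative_le by simp
  fix x assume x: "x \<in># lyap_exponents A" "x < 0"
  then obtain v where v: "v \<noteq> 0" "x = lyap_exponent A v"
    using in_exponentsD by blast
  then have span: "snd v \<in> span {\<alpha>}"
    using exponent_nonneg x(2) by (meson not_less)
  \<comment> \<open>A vector of the plane with nonzero area against \<open>v\<close> supplies the
    partner exponent.\<close>
  then obtain w where w: "snd w \<in> span {\<alpha>}" "area \<alpha> v w \<noteq> 0"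
    using area_nondegenerate[OF \<alpha> _ v(1)] by blast
  then have "w \<noteq> 0" by (auto simp: area_def)
  with w span v show "\<exists>y. y \<in># lyap_exponents A \<and> x + y \<ge> 0"
    using exponent_in_exponents exponent_add_nonneg by blast
qed

end

theorem proposition4:
  fixes V :: "('d::finite) torus \<Rightarrow> real"
    and \<alpha> :: "real ^ 'd"
    and \<epsilon> lam :: real
    and p :: "nat \<Rightarrow> real"
    and q :: "nat \<Rightarrow> 'd torus"
  assumes "torus_analytic V"
    and "\<And>k :: int ^ 'd. k \<noteq> 0 \<Longrightarrow> (\<Sum>i\<in>UNIV. of_int (k $ i) * \<alpha> $ i) \<noteq> 0"
    and "\<And>n. (p (Suc n), q (Suc n)) = F_map V \<alpha> \<epsilon> lam (p n, q n)"
    and "lyapunov_regular (derivative_cocycle (F_map V \<alpha> \<epsilon> lam) (p 0, q 0))"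
  shows "let L = lyap_exponents (derivative_cocycle (F_map V \<alpha> \<epsilon> lam) (p 0, q 0))
         in size L = CARD('d) + 1 \<and> count L 0 \<ge> CARD('d) - 1 \<and> sum_mset L = 0"
proof -
  define A where "A = derivative_cocycle (F_map V \<alpha> \<epsilon> lam) (p 0, q 0)"
  have A: "preserves_structure \<alpha> (A n)" for n
    unfolding A_def using assms(1) by (rule derivative_cocycle_preserves_structure)
  have regular: "lyapunov_regular A" unfolding A_def by (rule assms(4))
  \<comment> \<open>The nonresonance condition is applied to a unit vector at an arbitrary
    index.\<close>
  have "\<alpha> \<noteq> 0"
    using assms(2)[of "axis undefined 1"] by (auto simp: axis_eq_0_iff)
  then interpret structured_cocycle A \<alpha>
    using A regular unfolding lyapunov_regular_def
    by (intro structured_cocycle.intro structured_cocycle_axioms.intro convergent_cocycle.intro)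
      (auto intro: preserves_structure_linear preserves_structure_inj simp del: split_paired_All)
  \<comment> \<open>All determinants are 1, so the limit that regularity equates with the sum of the
    exponents is 0.\<close>
  have "(\<lambda>n. ln \<bar>phase_det (A n)\<bar> / real n) = (\<lambda>n. 0)"
    by (simp add: preserves_structure_det[OF A])
  then have "(\<lambda>n::nat. 0) \<longlonglongrightarrow> sum_mset (lyap_exponents A)"
    using regular unfolding lyapunov_regular_def by simp
  then have sum: "sum_mset (lyap_exponents A) = 0"
    using LIMSEQ_unique tendsto_const by blast
  have "size (lyap_exponents A) = CARD('d) + 1"
    by (simp add: size_exponents)
  with sum count_zero_exponents[OF sum] show ?thesis
    unfolding A_def[symmetric] Let_def by simp
qed

end
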